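(* Let $a,b$ be nonzero real numbers with $ab\neq -4$, let $\alpha,\beta$ be the roots of $x^2-abx-ab=0$, and let $\widetilde{Q}_n$ be the $n$th bi-periodic dual Fibonacci quaternion. Let $r$ be a nonnegative even integer and $n$ a nonnegative integer with $n\ge r$. With the quaternions $\alpha^{\ast},\beta^{\ast},\alpha^{\ast\ast},\beta^{\ast\ast}$ defined in the context, if $n$ is even, then $$\widetilde{Q}_{n-r}\widetilde{Q}_{n+r}-\widetilde{Q}_n^2=\frac{\alpha^{\ast}\beta^{\ast}((ab)^r-\beta^{2r})+\beta^{\ast}\alpha^{\ast}((ab)^r-\alpha^{2r})}{(ab)^r(\alpha-\beta)^2}$$ $$+\varepsilon\left[\frac{(\alpha^{\ast\ast}\beta^{\ast}\alpha+\alpha^{\ast}\beta^{\ast\ast}\beta)((ab)^r-\beta^{2r})+(\beta^{\ast}\alpha^{\ast\ast}\alpha+\beta^{\ast\ast}\alpha^{\ast}\beta)((ab)^r-\alpha^{2r})}{(ab)^r(\alpha-\beta)^2}\right],$$ and if $n$ is odd, then $$\widetilde{Q}_{n-r}\widetilde{Q}_{n+r}-\widetilde{Q}_n^2=-\frac{\alpha^{\ast\ast}\beta^{\ast\ast}((ab)^r-\beta^{2r})+\beta^{\ast\ast}\alpha^{\ast\ast}((ab)^r-\alpha^{2r})}{(ab)^{r-1}(\alpha-\beta)^2}$$ $$+\varepsilon\left\{-\frac{(\alpha^{\ast}\beta^{\ast\ast}\alpha+\alpha^{\ast\ast}\beta^{\ast}\beta)((ab)^r-\beta^{2r})+(\b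eta^{\ast}\alpha^{\ast\ast}\beta+\beta^{\ast\ast}\alpha^{\ast}\alpha)((ab)^r-\alpha^{2r})}{(ab)^r(\alpha-\beta)^2}\right\}.$$
   Context: For nonzero real numbers $a,b$, the bi-periodic Fibonacci numbers are defined by $F_0=0$, $F_1=1$ and, for $n\ge 2$, $F_n=aF_{n-1}+F_{n-2}$ if $n$ is even, $F_n=bF_{n-1}+F_{n-2}$ if $n$ is odd. The bi-periodic Fibonacci quaternions are $Q_n=F_n+F_{n+1}i+F_{n+2}j+F_{n+3}k$, where $i,j,k$ are the quaternion units: $i^2=j^2=k^2=ijk=-1$. The dual unit $\varepsilon\neq 0$ satisfies $\varepsilon^2=0$ and commutes with quaternions. The bi-periodic dual Fibonacci quaternions are $\widetilde{Q}_n=Q_n+\varepsilon Q_{n+1}$, and multiplication of dual quaternions is $(p+\varepsilon p')(q+\varepsilon q')=pq+\varepsilon(p'q+pq')$ with the (noncommutative) quaternion product. The numbers $\alpha,\beta$ are the two roots of $x^2-abx-ab=0$, so $\alpha+\beta=ab$ and $\alpha\beta=-ab$; if they are non-real, all expressions are read in quaternions with complex coefficients (scalars being central and distinct from the unit $i$). Define $$\alpha^{\ast}=a+\alpha i+\frac{a}{ab}\alpha^2 j+\frac{1}{ab}\alpha^3 k,\qquad \beta^{\ast}=a+\beta i+\frac{a}{ab}\beta^2 j+\frac{1}{ab}\beta^3 k,$$ $$\alpha^{\ast\ast}=1+\frac{a}{ab}\alpha i+\frac{1}{ab}\alpha^2 j+\frac{a}{(ab)^2}\alpha^3 k,\qquad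 \beta^{\ast\ast}=1+\frac{a}{ab}\beta i+\frac{1}{ab}\beta^2 j+\frac{a}{(ab)^2}\beta^3 k.$$ *)

theory Defs
  imports Complex_Main
begin

text \<open>
  Hamilton quaternions over an arbitrary commutative coefficient ring;
  \<open>Quat w x y z\<close> stands for w + x i + y j + z k. Over the complex numbers the coefficient
  imaginary unit is central and distinct from the quaternion unit i.
\<close>

datatype 'a quat = Quat (quat_re: 'a) (quat_i: 'a) (quat_j: 'a) (quat_k: 'a)

instantiation quat :: (comm_ring_1) ring_1
begin

definition zero_quat :: "'a quat" where "0 = Quat 0 0 0 0"

definition one_quat :: "'a quat" where "1 = Quat 1 0 0 0"

definition plus_quat :: "'a quat \<Rightarrow> 'a quat \<Rightarrow> 'a quat" where
  "p + q = Quat (quat_re p + quat_re q) (quat_i p + quat_i q)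
                (quat_j p + quat_j q) (quat_k p + quat_k q)"

definition uminus_quat :: "'a quat \<Rightarrow> 'a quat" where
  "- p = Quat (- quat_re p) (- quat_i p) (- quat_j p) (- quat_k p)"

definition minus_quat :: "'a quat \<Rightarrow> 'a quat \<Rightarrow> 'a quat" where
  "p - q = Quat (quat_re p - quat_re q) (quat_i p - quat_i q)
                (quat_j p - quat_j q) (quat_k p - quat_k q)"

definition times_quat :: "'a quat \<Rightarrow> 'a quat \<Rightarrow> 'a quat" where
  "p * q = Quat
    (quat_re p * quat_re q - quat_i p * quat_i q - quat_j p * quat_j q - quat_k p * quat_k q)
    (quat_re p * quat_i q + quat_i p * quat_re q + quat_j p * quat_k q - quat_k p * quat_j q)
    (quat_re p * quat_j q - quat_i p * quat_k q + quat_j p * quat_re q + quat_k p * quat_i q)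
    (quat_re p * quat_k q + quat_i p * quat_j q - quat_j p * quat_i q + quat_k p * quat_re q)"

instance
  by standard
    (auto simp: zero_quat_def one_quat_def plus_quat_def uminus_quat_def minus_quat_def
      times_quat_def quat.expand algebra_simps)

end

definition scale_quat :: "'a::comm_ring_1 \<Rightarrow> 'a quat \<Rightarrow> 'a quat" (infixr "*\<^sub>q" 75) where
  "c *\<^sub>q p = Quat (c * quat_re p) (c * quat_i p) (c * quat_j p) (c * quat_k p)"

definition qi :: "'a::comm_ring_1 quat" where "qi = Quat 0 1 0 0"
definition qj :: "'a::comm_ring_1 quat" where "qj = Quat 0 0 1 0"
definition qk :: "'a::comm_ring_1 quat" where "qk = Quat 0 0 0 1"

lemma quat_units:
  "qi ^ 2 = (-1 :: 'a::comm_ring_1 quat)" "qj ^ 2 = (-1 :: 'a quat)"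
  "qk ^ 2 = (-1 :: 'a quat)" "qi * qj * qk = (-1 :: 'a quat)"
  by (simp_all add: qi_def qj_def qk_def one_quat_def uminus_quat_def times_quat_def
      power2_eq_square)

lemma Quat_eq_units: "Quat w x y z = w *\<^sub>q 1 + x *\<^sub>q qi + y *\<^sub>q qj + z *\<^sub>q qk"
  by (simp add: qi_def qj_def qk_def one_quat_def scale_quat_def plus_quat_def)

lemma scale_quat_eq_times: "c *\<^sub>q p = Quat c 0 0 0 * p" "c *\<^sub>q p = p * Quat c 0 0 0"
  by (simp_all add: scale_quat_def times_quat_def mult.commute)


text \<open>
  Dual numbers over a (possibly noncommutative) ring; \<open>Dual p p'\<close> stands for
  p + \<open>\<epsilon>\<close> p', where \<open>\<epsilon>\<close> is central and squares to zero.
\<close>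

datatype 'a dual_num = Dual (dual_std: 'a) (dual_eps: 'a)

instantiation dual_num :: (ring_1) ring_1
begin

definition zero_dual_num :: "'a dual_num" where "0 = Dual 0 0"

definition one_dual_num :: "'a dual_num" where "1 = Dual 1 0"

definition plus_dual_num :: "'a dual_num \<Rightarrow> 'a dual_num \<Rightarrow> 'a dual_num" where
  "x + y = Dual (dual_std x + dual_std y) (dual_eps x + dual_eps y)"

definition uminus_dual_num :: "'a dual_num \<Rightarrow> 'a dual_num" where
  "- x = Dual (- dual_std x) (- dual_eps x)"

definition minus_dual_num :: "'a dual_num \<Rightarrow> 'a dual_num \<Rightarrow> 'a dual_num" where
  "x - y = Dual (dual_std x - dual_std y) (dual_eps x - dual_eps y)"

definition times_dual_num :: "'a dual_num \<Rightarrow> 'a dual_num \<Rightarrow> 'a dual_num" where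
  "x * y = Dual (dual_std x * dual_std y) (dual_eps x * dual_std y + dual_std x * dual_eps y)"

instance
  by standard
    (auto simp: zero_dual_num_def one_dual_num_def plus_dual_num_def uminus_dual_num_def
      minus_dual_num_def times_dual_num_def dual_num.expand algebra_simps)

end

lemma dual_unit:
  "Dual 0 1 * Dual 0 1 = (0 :: 'a::ring_1 dual_num)"
  "Dual 0 1 \<noteq> (0 :: 'a dual_num)"
  "Dual p p' = Dual p 0 + Dual 0 1 * Dual p' (0::'a)"
  "Dual 0 1 * Dual p (0::'a) = Dual p 0 * Dual 0 1"
  by (simp_all add: zero_dual_num_def plus_dual_num_def times_dual_num_def)


fun biper_fib :: "real \<Rightarrow> real \<Rightarrow> nat \<Rightarrow> real" where
  "biper_fib a b 0 = 0"
| "biper_fib a b (Suc 0) = 1"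
| "biper_fib a b (Suc (Suc n)) =
    (if even (Suc (Suc n)) then a else b) * biper_fib a b (Suc n) + biper_fib a b n"

definition biper_quat :: "real \<Rightarrow> real \<Rightarrow> nat \<Rightarrow> real quat" where
  "biper_quat a b n =
    Quat (biper_fib a b n) (biper_fib a b (n + 1)) (biper_fib a b (n + 2)) (biper_fib a b (n + 3))"

definition biper_dual_quat :: "real \<Rightarrow> real \<Rightarrow> nat \<Rightarrow> real quat dual_num" where
  "biper_dual_quat a b n = Dual (biper_quat a b n) (biper_quat a b (n + 1))"

text \<open>The coefficientwise inclusion of real into complex dual quaternions.\<close>

definition complexify :: "real quat dual_num \<Rightarrow> complex quat dual_num" where
  "complexify = map_dual_num (map_quat complex_of_real)"

text \<open>
  For a root \<open>x\<close> of \<open>x\<^sup>2 - abx - ab\<close>, the following two quaternions are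
  x* and x** respectively.
\<close>

definition star_quat :: "real \<Rightarrow> real \<Rightarrow> complex \<Rightarrow> complex quat" where
  "star_quat a b x =
    (let a' = complex_of_real a; ab = complex_of_real (a * b)
     in Quat a' x (a' / ab * x ^ 2) (1 / ab * x ^ 3))"

definition starstar_quat :: "real \<Rightarrow> real \<Rightarrow> complex \<Rightarrow> complex quat" where
  "starstar_quat a b x =
    (let a' = complex_of_real a; ab = complex_of_real (a * b)
     in Quat 1 (a' / ab * x) (1 / ab * x ^ 2) (a' / ab ^ 2 * x ^ 3))"

end

theory Submission
  imports Defs
begin

text \<open>
  With \<open>c = ab\<close>, Binet's formula reads \<open>Q\<^sub>n = (\<alpha>\<^sup>n U - \<beta>\<^sup>n V) / (c\<^bsup>n div 2\<^esup> (\<alpha> - \<beta>))\<close>, where \<open>(U, V)\<close> is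
  \<open>(\<alpha>*, \<beta>*)\<close> for even \<open>n\<close> and \<open>(\<alpha>**, \<beta>**)\<close> for odd \<open>n\<close>. In \<open>Q\<^bsub>n-r\<^esub> Q\<^bsub>n+r\<^esub> - Q\<^sub>n\<^sup>2\<close> the terms in
  \<open>\<alpha>\<^bsup>2n\<^esup>\<close> and \<open>\<beta>\<^bsup>2n\<^esup>\<close> cancel, and the mixed terms carry the common factor \<open>(\<alpha>\<beta>)\<^bsup>n-r\<^esup> = (-c)\<^bsup>n-r\<^esup>\<close>.
  The same bilinear cancellation, applied to each of the two products that make up the dual part,
  gives the coefficient of \<open>\<epsilon>\<close>.
\<close>

section \<open>Central scalars and the bilinear cancellation\<close>

interpretation quat: module scale_quat
  by standard (simp_all add: scale_quat_def plus_quat_def algebra_simps)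

lemma mult_scale_quat_left [simp]: "(c *\<^sub>q p) * q = c *\<^sub>q (p * q)"
  by (simp add: scale_quat_eq_times(1) mult.assoc)

lemma mult_scale_quat_right [simp]: "p * (c *\<^sub>q q) = c *\<^sub>q (p * q)"
  by (simp add: scale_quat_eq_times(2) mult.assoc)

text \<open>The coefficients of \<open>U * X\<close> and \<open>V * Y\<close> vanish because n - r
  and n + r add up to 2n; the cross terms keep their order, since quaternions do not commute.
  \<open>U\<close>, \<open>V\<close> are independent of \<open>X\<close>, \<open>Y\<close> so that
  products pairing a starred with a double-starred quaternion are covered too. Only the products of
  the prefactors have to agree, which absorbs the different exponents of c.\<close>

lemma catalan_bilinear:
  fixes x y :: "'a::comm_ring_1" and U V X Y :: "'a quat"
  assumes "r \<le> n" and "c1 * c2 = K" and "d1 * d2 = K"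
  shows "(c1 *\<^sub>q (x ^ (n - r) *\<^sub>q U - y ^ (n - r) *\<^sub>q V)) * (c2 *\<^sub>q (x ^ (n + r) *\<^sub>q X - y ^ (n + r) *\<^sub>q Y))
       - (d1 *\<^sub>q (x ^ n *\<^sub>q U - y ^ n *\<^sub>q V)) * (d2 *\<^sub>q (x ^ n *\<^sub>q X - y ^ n *\<^sub>q Y))
       = (K * (x * y) ^ (n - r)) *\<^sub>q
           (((x * y) ^ r - y ^ (2 * r)) *\<^sub>q (U * Y) + ((x * y) ^ r - x ^ (2 * r)) *\<^sub>q (V * X))"
proof -
  \<comment> \<open>This removes truncated subtraction: n - r becomes k.\<close>
  obtain k where n: "n = r + k"
    using assms(1) le_Suc_ex by blast
  have sq: "z ^ (2 * r) = z ^ r * z ^ r" for z :: 'a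
    by (simp add: mult_2 power_add)
  have "(c1 *\<^sub>q (x ^ (n - r) *\<^sub>q U - y ^ (n - r) *\<^sub>q V)) * (c2 *\<^sub>q (x ^ (n + r) *\<^sub>q X - y ^ (n + r) *\<^sub>q Y))
       - (d1 *\<^sub>q (x ^ n *\<^sub>q U - y ^ n *\<^sub>q V)) * (d2 *\<^sub>q (x ^ n *\<^sub>q X - y ^ n *\<^sub>q Y))
     = (c1 * c2) *\<^sub>q ((x ^ (n - r) *\<^sub>q U - y ^ (n - r) *\<^sub>q V) * (x ^ (n + r) *\<^sub>q X - y ^ (n + r) *\<^sub>q Y))
       - (d1 * d2) *\<^sub>q ((x ^ n *\<^sub>q U - y ^ n *\<^sub>q V) * (x ^ n *\<^sub>q X - y ^ n *\<^sub>q Y))"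
    by (simp add: quat.scale_scale mult.commute[of c2] mult.commute[of d2])
  also have "\<dots> = K *\<^sub>q
      ((x ^ (n - r) * x ^ (n + r) - x ^ n * x ^ n) *\<^sub>q (U * X)
       + (x ^ n * y ^ n - x ^ (n - r) * y ^ (n + r)) *\<^sub>q (U * Y)
       + (x ^ n * y ^ n - y ^ (n - r) * x ^ (n + r)) *\<^sub>q (V * X)
       + (y ^ (n - r) * y ^ (n + r) - y ^ n * y ^ n) *\<^sub>q (V * Y))"
    unfolding assms(2,3)
    by (simp add: left_diff_distrib right_diff_distrib quat.scale_left_diff_distrib
        quat.scale_right_diff_distrib quat.scale_right_distrib mult_ac)
  also have "x ^ (n - r) * x ^ (n + r) - x ^ n * x ^ n = 0"
    by (simp add: n power_add mult_ac)
  also have "y ^ (n - r) * y ^ (n + r) - y ^ n * y ^ n = 0"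
    by (simp add: n power_add mult_ac)
  also have "x ^ n * y ^ n - x ^ (n - r) * y ^ (n + r) = (x * y) ^ (n - r) * ((x * y) ^ r - y ^ (2 * r))"
    unfolding sq by (simp add: n power_add power_mult_distrib right_diff_distrib mult_ac)
  also have "x ^ n * y ^ n - y ^ (n - r) * x ^ (n + r) = (x * y) ^ (n - r) * ((x * y) ^ r - x ^ (2 * r))"
    unfolding sq by (simp add: n power_add power_mult_distrib right_diff_distrib mult_ac)
  finally show ?thesis
    by (simp add: quat.scale_right_distrib mult_ac)
qed

text \<open>The dual part is regrouped by which factor carries the shifted quaternion, left or
  right, so that each difference has the shape of \<open>catalan_bilinear\<close>.\<close>

lemma complexify_Dual_diff_mult:
  "complexify (Dual p p' * Dual q q' - Dual s s' ^ 2) =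
    (let h = map_quat complex_of_real in
     Dual (h p * h q - h s * h s)
       ((h p' * h q - h s' * h s) + (h p * h q' - h s * h s')))"
  by (simp add: complexify_def Let_def power2_eq_square times_dual_num_def minus_dual_num_def
      times_quat_def minus_quat_def plus_quat_def quat.map_sel algebra_simps)

section \<open>Vieta relations for the two roots\<close>

text \<open>The set equation alone allows a double root. The reflection x -> c - x preserves the
  polynomial, so c - \<alpha> is again a root; it differs from \<alpha> because the discriminant c(c
  + 4) is nonzero, hence it is \<beta>.\<close>

lemma quadratic_roots:
  fixes c :: complex
  assumes "{x. x ^ 2 - c * x - c = 0} = {\<alpha>, \<beta>}" and "c \<noteq> 0" and "c \<noteq> -4"
  shows "\<alpha> + \<beta> = c" and "\<alpha> * \<beta> = - c" and "\<alpha> \<noteq> \<beta>"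
proof -
  have \<alpha>: "\<alpha> ^ 2 - c * \<alpha> - c = 0"
    using assms(1) by blast
  have ne: "c \<noteq> 2 * \<alpha>"
  proof
    assume c: "c = 2 * \<alpha>"
    \<comment> \<open>Substituting c = 2\<alpha> into the equation; the solutions 0 and -2 give the
      excluded values c = 0 and c = -4.\<close>
    then have "\<alpha> * (\<alpha> + 2) = 0"
      using \<alpha> by algebra
    then have "\<alpha> = 0 \<or> \<alpha> = -2"
      by (metis add.commute add.inverse_unique minus_minus mult_eq_0_iff)
    then show False
      using c assms(2,3) by auto
  qed
  have "(c - \<alpha>) ^ 2 - c * (c - \<alpha>) - c = 0"
    using \<alpha> by (simp add: power2_eq_square algebra_simps)
  then have "c - \<alpha> \<in> {\<alpha>, \<beta>}"
    using assms(1) by blast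
  then show sum: "\<alpha> + \<beta> = c"
    using ne by auto
  show "\<alpha> * \<beta> = - c"
    using \<alpha> sum by algebra
  show "\<alpha> \<noteq> \<beta>"
    using ne sum by auto
qed

section \<open>Binet formulas for the numbers and the quaternions\<close>

context
  fixes a b :: real and \<alpha> \<beta> c :: complex
  assumes ab: "a \<noteq> 0" "b \<noteq> 0" and c: "c = complex_of_real (a * b)"
    and sum: "\<alpha> + \<beta> = c" and prod: "\<alpha> * \<beta> = - c" and ne: "\<alpha> \<noteq> \<beta>"
begin

lemma c_nonzero: "c \<noteq> 0"
  using ab c by simp

text \<open>Powers of either root satisfy u(n+2) = c (u(n+1) + u(n)). The parity factor and the
  exponent \<open>n div 2\<close> convert this into the bi-periodic recurrence: from n to n + 2 the
  denominator gains exactly one c.\<close>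

lemma binet:
  "complex_of_real (biper_fib a b n) =
    (if even n then complex_of_real a else 1) / (c ^ (n div 2) * (\<alpha> - \<beta>)) * (\<alpha> ^ n - \<beta> ^ n)"
proof (induction n rule: induct_nat_012)
  case (ge2 n)
  have step: "x ^ Suc (Suc n) = c * (x ^ Suc n + x ^ n)" if "x \<in> {\<alpha>, \<beta>}" for x
  proof -
    have "x ^ 2 = c * (x + 1)"
      using that prod by (auto simp: power2_eq_square algebra_simps simp flip: sum)
    then have "x ^ 2 * x ^ n = c * (x + 1) * x ^ n"
      by simp
    then show ?thesis
      by (simp add: power2_eq_square algebra_simps)
  qed
  have step': "\<alpha> ^ Suc (Suc n) - \<beta> ^ Suc (Suc n)
      = c * ((\<alpha> ^ Suc n - \<beta> ^ Suc n) + (\<alpha> ^ n - \<beta> ^ n))"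
    using step[of \<alpha>] step[of \<beta>] by (simp add: algebra_simps)
  show ?case
  proof (cases "even n")
    case True
    then have "Suc n div 2 = n div 2" "Suc (Suc n) div 2 = Suc (n div 2)"
      by auto
    then show ?thesis
      using True ne c_nonzero unfolding biper_fib.simps step'
      by (simp add: ge2 divide_simps del: power_Suc) (simp add: algebra_simps)
  next
    case False
    then have d: "Suc n div 2 = Suc (n div 2)" "Suc (Suc n) div 2 = Suc (n div 2)"
      by auto
    \<comment> \<open>For odd n the term F(n+1) has one more c in its denominator than F(n); the
      product of b with its parity factor a cancels it.\<close>
    have "complex_of_real b * complex_of_real a = c"
      by (simp add: c)
    then show ?thesis
      using False ne c_nonzero ab d unfolding biper_fib.simps step'
      by (simp add: ge2 divide_simps del: power_Suc) (simp add: algebra_simps c)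
  qed
qed (use ne in auto)

text \<open>Relative to the prefactor of F(n), the components n, ..., n + 3 contribute root powers
  0, ..., 3, parity factors a, 1, a, 1 and denominators 1, 1, c, c: the entries of
  \<open>star_quat\<close>. For odd n the factors are 1, a, 1, a and the denominators 1, c, c, c^2,
  which gives \<open>starstar_quat\<close>.\<close>

lemma complexified_quat_even:
  assumes "even n"
  shows "map_quat complex_of_real (biper_quat a b n) =
    (1 / (c ^ (n div 2) * (\<alpha> - \<beta>))) *\<^sub>q (\<alpha> ^ n *\<^sub>q star_quat a b \<alpha> - \<beta> ^ n *\<^sub>q star_quat a b \<beta>)"
proof -
  define m where "m = n div 2"
  have F0: "complex_of_real (biper_fib a b n) = complex_of_real a / (c ^ m * (\<alpha> - \<beta>)) * (\<alpha> ^ n - \<beta> ^ n)"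
    and F1: "complex_of_real (biper_fib a b (n + 1)) = 1 / (c ^ m * (\<alpha> - \<beta>)) * (\<alpha> ^ (n + 1) - \<beta> ^ (n + 1))"
    and F2: "complex_of_real (biper_fib a b (n + 2)) = complex_of_real a / (c ^ (m + 1) * (\<alpha> - \<beta>)) * (\<alpha> ^ (n + 2) - \<beta> ^ (n + 2))"
    and F3: "complex_of_real (biper_fib a b (n + 3)) = 1 / (c ^ (m + 1) * (\<alpha> - \<beta>)) * (\<alpha> ^ (n + 3) - \<beta> ^ (n + 3))"
    using assms unfolding binet m_def by (auto elim!: evenE)
  show ?thesis
    using ne c_nonzero
    unfolding biper_quat_def star_quat_def Let_def scale_quat_def minus_quat_def quat.map quat.sel
      quat.inject F0 F1 F2 F3 m_def[symmetric] c[symmetric]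
    by (simp add: field_simps power_add power2_eq_square power3_eq_cube)
qed

lemma complexified_quat_odd:
  assumes "odd n"
  shows "map_quat complex_of_real (biper_quat a b n) =
    (1 / (c ^ (n div 2) * (\<alpha> - \<beta>))) *\<^sub>q (\<alpha> ^ n *\<^sub>q starstar_quat a b \<alpha> - \<beta> ^ n *\<^sub>q starstar_quat a b \<beta>)"
proof -
  define m where "m = n div 2"
  have F0: "complex_of_real (biper_fib a b n) = 1 / (c ^ m * (\<alpha> - \<beta>)) * (\<alpha> ^ n - \<beta> ^ n)"
    and F1: "complex_of_real (biper_fib a b (n + 1)) = complex_of_real a / (c ^ (m + 1) * (\<alpha> - \<beta>)) * (\<alpha> ^ (n + 1) - \<beta> ^ (n + 1))"
    and F2: "complex_of_real (biper_fib a b (n + 2)) = 1 / (c ^ (m + 1) * (\<alpha> - \<beta>)) * (\<alpha> ^ (n + 2) - \<beta> ^ (n + 2))"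
    and F3: "complex_of_real (biper_fib a b (n + 3)) = complex_of_real a / (c ^ (m + 2) * (\<alpha> - \<beta>)) * (\<alpha> ^ (n + 3) - \<beta> ^ (n + 3))"
    using assms unfolding binet m_def by (auto elim!: oddE)
  show ?thesis
    using ne c_nonzero
    unfolding biper_quat_def starstar_quat_def Let_def scale_quat_def minus_quat_def quat.map quat.sel
      quat.inject F0 F1 F2 F3 m_def[symmetric] c[symmetric]
    by (simp add: field_simps power_add power2_eq_square power3_eq_cube)
qed

text \<open>One root factor moves into the quaternion, so that the shifted quaternion has the same
  outer powers as the unshifted one and \<open>catalan_bilinear\<close> applies. This produces the
  extra \<alpha> and \<beta> in the dual part.\<close>

lemma complexified_quat_Suc_even:
  assumes "even n"
  shows "map_quat complex_of_real (biper_quat a b (n + 1)) =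
    (1 / (c ^ (n div 2) * (\<alpha> - \<beta>))) *\<^sub>q
      (\<alpha> ^ n *\<^sub>q (\<alpha> *\<^sub>q starstar_quat a b \<alpha>) - \<beta> ^ n *\<^sub>q (\<beta> *\<^sub>q starstar_quat a b \<beta>))"
  using assms complexified_quat_odd[of "n + 1"] by (simp add: quat.scale_scale mult.commute)

lemma complexified_quat_Suc_odd:
  assumes "odd n"
  shows "map_quat complex_of_real (biper_quat a b (n + 1)) =
    (1 / (c ^ ((n + 1) div 2) * (\<alpha> - \<beta>))) *\<^sub>q
      (\<alpha> ^ n *\<^sub>q (\<alpha> *\<^sub>q star_quat a b \<alpha>) - \<beta> ^ n *\<^sub>q (\<beta> *\<^sub>q star_quat a b \<beta>))"
  using assms complexified_quat_even[of "n + 1"] by (simp add: quat.scale_scale mult.commute)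

section \<open>Catalan identities by the parity of n\<close>

text \<open>For even n the quaternion and its successor share the prefactor with exponent
  \<open>n div 2\<close>, so one constant \<open>K\<close> serves the standard part and both halves
  of the dual part. No sign appears because n - r is even.\<close>

lemma catalan_even:
  assumes "even r" and "r \<le> n" and "even n"
  shows "complexify (biper_dual_quat a b (n - r) * biper_dual_quat a b (n + r) - biper_dual_quat a b n ^ 2) =
    (let \<alpha>1 = star_quat a b \<alpha>; \<beta>1 = star_quat a b \<beta>;
         \<alpha>2 = starstar_quat a b \<alpha>; \<beta>2 = starstar_quat a b \<beta>
     in Dual
          ((1 / (c ^ r * (\<alpha> - \<beta>) ^ 2)) *\<^sub>q
            ((c ^ r - \<beta> ^ (2 * r)) *\<^sub>q (\<alpha>1 * \<beta>1) + (c ^ r - \<alpha> ^ (2 * r)) *\<^sub>q (\<beta>1 * \<alpha>1)))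
          ((1 / (c ^ r * (\<alpha> - \<beta>) ^ 2)) *\<^sub>q
            ((c ^ r - \<beta> ^ (2 * r)) *\<^sub>q (\<alpha> *\<^sub>q (\<alpha>2 * \<beta>1) + \<beta> *\<^sub>q (\<alpha>1 * \<beta>2)) +
             (c ^ r - \<alpha> ^ (2 * r)) *\<^sub>q (\<alpha> *\<^sub>q (\<beta>1 * \<alpha>2) + \<beta> *\<^sub>q (\<beta>2 * \<alpha>1)))))"
proof -
  obtain s where r: "r = 2 * s"
    using assms(1) by auto
  obtain m where n: "n = 2 * m"
    using assms(3) by auto
  define t where "t = m - s"
  have m: "m = s + t"
    using assms(2) by (simp add: t_def r n)
  define D where "D = \<alpha> - \<beta>"
  define K where "K = 1 / (c ^ n * D ^ 2)"
  have K1: "1 / (c ^ ((n - r) div 2) * D) * (1 / (c ^ ((n + r) div 2) * D)) = K"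
    and K2: "1 / (c ^ (n div 2) * D) * (1 / (c ^ (n div 2) * D)) = K"
    by (simp_all add: K_def r n m power_add power_mult power2_eq_square mult_ac power_mult_distrib)
  have K: "K * (\<alpha> * \<beta>) ^ (n - r) = 1 / (c ^ r * D ^ 2)"
    using c_nonzero by (simp add: K_def prod r n m power_add)
  have P: "(\<alpha> * \<beta>) ^ r = c ^ r"
    using assms(1) by (simp add: prod)
  have ev: "even (n - r)" "even (n + r)"
    using assms by auto
  \<comment> \<open>The four quaternions stay schematic, so this single fact rewrites all three
    differences.\<close>
  note cat = catalan_bilinear[OF assms(2) K1 K2, where x = \<alpha> and y = \<beta>, unfolded K P]
  show ?thesis
    unfolding biper_dual_quat_def complexify_Dual_diff_mult Let_def
      complexified_quat_even[OF ev(1)] complexified_quat_even[OF ev(2)]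
      complexified_quat_even[OF assms(3)] complexified_quat_Suc_even[OF ev(1)]
      complexified_quat_Suc_even[OF ev(2)] complexified_quat_Suc_even[OF assms(3)]
      D_def[symmetric] cat
    by (simp add: quat.scale_right_distrib add_ac mult_ac)
qed

text \<open>The minus signs come from (-c)^(n-r) with n - r odd. Passing to the successor now raises
  the exponent of c by one: the total is n - 1 in the standard part (\<open>K\<close>) but n in the
  dual part (\<open>L\<close>), whence the denominators with c^(r-1) and c^r.\<close>

lemma catalan_odd:
  assumes "even r" and "r \<le> n" and "odd n"
  shows "complexify (biper_dual_quat a b (n - r) * biper_dual_quat a b (n + r) - biper_dual_quat a b n ^ 2) =
    (let \<alpha>1 = star_quat a b \<alpha>; \<beta>1 = star_quat a b \<beta>;
         \<alpha>2 = starstar_quat a b \<alpha>; \<beta>2 = starstar_quat a b \<beta>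
     in Dual
          (- ((1 / (c powi (int r - 1) * (\<alpha> - \<beta>) ^ 2)) *\<^sub>q
            ((c ^ r - \<beta> ^ (2 * r)) *\<^sub>q (\<alpha>2 * \<beta>2) + (c ^ r - \<alpha> ^ (2 * r)) *\<^sub>q (\<beta>2 * \<alpha>2))))
          (- ((1 / (c ^ r * (\<alpha> - \<beta>) ^ 2)) *\<^sub>q
            ((c ^ r - \<beta> ^ (2 * r)) *\<^sub>q (\<alpha> *\<^sub>q (\<alpha>1 * \<beta>2) + \<beta> *\<^sub>q (\<alpha>2 * \<beta>1)) +
             (c ^ r - \<alpha> ^ (2 * r)) *\<^sub>q (\<beta> *\<^sub>q (\<beta>1 * \<alpha>2) + \<alpha> *\<^sub>q (\<beta>2 * \<alpha>1))))))"
proof -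
  obtain s where r: "r = 2 * s"
    using assms(1) by auto
  obtain m where n: "n = 2 * m + 1"
    using assms(3) oddE by blast
  define t where "t = m - s"
  have m: "m = s + t"
    using assms(2) by (simp add: t_def r n)
  have h: "n - r = 2 * t + 1" "(n - r) div 2 = t" "(n + r) div 2 = 2 * s + t" "n div 2 = s + t"
    "(n - r + 1) div 2 = t + 1" "(n + r + 1) div 2 = 2 * s + t + 1" "(n + 1) div 2 = s + t + 1"
    by (simp_all add: r n m)
  define D where "D = \<alpha> - \<beta>"
  define K where "K = 1 / (c ^ (2 * (s + t)) * D ^ 2)"
  define L where "L = 1 / (c ^ n * D ^ 2)"
  have K1: "1 / (c ^ ((n - r) div 2) * D) * (1 / (c ^ ((n + r) div 2) * D)) = K"
    and K2: "1 / (c ^ (n div 2) * D) * (1 / (c ^ (n div 2) * D)) = K"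
    unfolding h by (simp_all add: K_def power_add power_mult power2_eq_square mult_ac power_mult_distrib)
  \<comment> \<open>\<open>L1\<close> and \<open>L2\<close> treat products whose left factor is
    shifted, \<open>L3\<close> and \<open>L4\<close> those whose right factor is.\<close>
  have L1: "1 / (c ^ ((n - r + 1) div 2) * D) * (1 / (c ^ ((n + r) div 2) * D)) = L"
    and L2: "1 / (c ^ ((n + 1) div 2) * D) * (1 / (c ^ (n div 2) * D)) = L"
    and L3: "1 / (c ^ ((n - r) div 2) * D) * (1 / (c ^ ((n + r + 1) div 2) * D)) = L"
    and L4: "1 / (c ^ (n div 2) * D) * (1 / (c ^ ((n + 1) div 2) * D)) = L"
    unfolding h by (simp_all add: L_def n m power_add power_mult power2_eq_square mult_ac power_mult_distrib)
  \<comment> \<open>An integer power, since r = 0 makes the exponent -1.\<close>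
  have "c powi (int r - 1) = c ^ r / c"
    using c_nonzero by (simp add: power_int_diff)
  then have K: "K * (\<alpha> * \<beta>) ^ (n - r) = - (1 / (c powi (int r - 1) * D ^ 2))"
    using c_nonzero unfolding h by (simp add: K_def prod r power_add)
  have L: "L * (\<alpha> * \<beta>) ^ (n - r) = - (1 / (c ^ r * D ^ 2))"
    using c_nonzero unfolding h by (simp add: L_def prod r n m power_add)
  have P: "(\<alpha> * \<beta>) ^ r = c ^ r"
    using assms(1) by (simp add: prod)
  have od: "odd (n - r)" "odd (n + r)"
    using assms by auto
  note cat = catalan_bilinear[OF assms(2) K1 K2, where x = \<alpha> and y = \<beta>, unfolded K P]
    catalan_bilinear[OF assms(2) L1 L2, where x = \<alpha> and y = \<beta>, unfolded L P]
    catalan_bilinear[OF assms(2) L3 L4, where x = \<alpha> and y = \<beta>, unfolded L P]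
  show ?thesis
    unfolding biper_dual_quat_def complexify_Dual_diff_mult Let_def
      complexified_quat_odd[OF od(1)] complexified_quat_odd[OF od(2)]
      complexified_quat_odd[OF assms(3)] complexified_quat_Suc_odd[OF od(1)]
      complexified_quat_Suc_odd[OF od(2)] complexified_quat_Suc_odd[OF assms(3)]
      D_def[symmetric] cat
    by (simp add: quat.scale_right_distrib add_ac mult_ac)
qed

end

theorem theorem3p3:
  fixes a b :: real and \<alpha> \<beta> :: complex and n r :: nat
  assumes "a \<noteq> 0" and "b \<noteq> 0" and "a * b \<noteq> -4"
    and "{x :: complex. x ^ 2 - complex_of_real (a * b) * x - complex_of_real (a * b) = 0} = {\<alpha>, \<beta>}"
    and "even r" and "r \<le> n"
  shows
    "let ab = complex_of_real (a * b);
         Q = biper_dual_quat a b;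
         \<alpha>1 = star_quat a b \<alpha>; \<beta>1 = star_quat a b \<beta>;
         \<alpha>2 = starstar_quat a b \<alpha>; \<beta>2 = starstar_quat a b \<beta>
     in
      (even n \<longrightarrow>
        complexify (Q (n - r) * Q (n + r) - Q n ^ 2) =
        Dual
          ((1 / (ab ^ r * (\<alpha> - \<beta>) ^ 2)) *\<^sub>q
            ((ab ^ r - \<beta> ^ (2 * r)) *\<^sub>q (\<alpha>1 * \<beta>1) + (ab ^ r - \<alpha> ^ (2 * r)) *\<^sub>q (\<beta>1 * \<alpha>1)))
          ((1 / (ab ^ r * (\<alpha> - \<beta>) ^ 2)) *\<^sub>q
            ((ab ^ r - \<beta> ^ (2 * r)) *\<^sub>q (\<alpha> *\<^sub>q (\<alpha>2 * \<beta>1) + \<beta> *\<^sub>q (\<alpha>1 * \<beta>2)) +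
             (ab ^ r - \<alpha> ^ (2 * r)) *\<^sub>q (\<alpha> *\<^sub>q (\<beta>1 * \<alpha>2) + \<beta> *\<^sub>q (\<beta>2 * \<alpha>1))))) \<and>
      (odd n \<longrightarrow>
        complexify (Q (n - r) * Q (n + r) - Q n ^ 2) =
        Dual
          (- ((1 / (ab powi (int r - 1) * (\<alpha> - \<beta>) ^ 2)) *\<^sub>q
            ((ab ^ r - \<beta> ^ (2 * r)) *\<^sub>q (\<alpha>2 * \<beta>2) + (ab ^ r - \<alpha> ^ (2 * r)) *\<^sub>q (\<beta>2 * \<alpha>2))))
          (- ((1 / (ab ^ r * (\<alpha> - \<beta>) ^ 2)) *\<^sub>q
            ((ab ^ r - \<beta> ^ (2 * r)) *\<^sub>q (\<alpha> *\<^sub>q (\<alpha>1 * \<beta>2) + \<beta> *\<^sub>q (\<alpha>2 * \<beta>1)) +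
             (ab ^ r - \<alpha> ^ (2 * r)) *\<^sub>q (\<beta> *\<^sub>q (\<beta>1 * \<alpha>2) + \<alpha> *\<^sub>q (\<beta>2 * \<alpha>1))))))"
proof -
  define c where "c = complex_of_real (a * b)"
  have "c \<noteq> 0"
    using assms(1,2) by (simp add: c_def)
  moreover have "c \<noteq> -4"
    using assms(3) unfolding c_def
    by (metis of_real_eq_iff of_real_minus of_real_numeral)
  ultimately have roots: "\<alpha> + \<beta> = c" "\<alpha> * \<beta> = - c" "\<alpha> \<noteq> \<beta>"
    using quadratic_roots[OF assms(4)[folded c_def]] by blast+
  show ?thesis
    using catalan_even[OF assms(1,2) c_def roots assms(5,6)]
      catalan_odd[OF assms(1,2) c_def roots assms(5,6)]
    unfolding Let_def c_def by blast
qed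

end
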